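(* Let $p\in\mathbb{C}[z]$ be a nonconstant polynomial with only simple zeros and let $Z_p=\{(x,y,z)\in\mathbb{C}^3 : xy=p(z)\}$ be the corresponding smooth Danielewski surface. The complete vector fields $V,\ W,\ H,\ zW,\ zV,\ zH$ generate the Lie algebra of all polynomial vector fields on $Z_p$.
   Context: On $Z_p$ the following vector fields are considered: $V=p'(z)\frac{\partial}{\partial x}+y\frac{\partial}{\partial z}$, $W=p'(z)\frac{\partial}{\partial y}+x\frac{\partial}{\partial z}$, $H=-x\frac{\partial}{\partial x}+y\frac{\partial}{\partial y}$ (they are tangent to $Z_p$). For a regular function $f$ on $Z_p$, $f\Theta$ denotes the vector field $\Theta$ multiplied by $f$. A polynomial vector field on $Z_p$ is an algebraic vector field, i.e. a $\mathbb{C}$-derivation of the coordinate ring $\mathbb{C}[Z_p]$. A holomorphic vector field is complete if its flow map exists for all complex times $t\in\mathbb{C}$. "Generate" means generate as a complex Lie algebra under the Lie bracket of vector fields. *)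

theory Defs
  imports "HOL-Analysis.Analysis" "HOL-Computational_Algebra.Polynomial" "HOL-Library.FuncSet"
begin

type_synonym point = "complex \<times> complex \<times> complex"

definition danielewski :: "complex poly \<Rightarrow> point set" where
  "danielewski p = {(x, y, z). x * y = poly p z}"

inductive_set polyfun3 :: "(point \<Rightarrow> complex) set" where
  const: "(\<lambda>_. c) \<in> polyfun3"
| coord_x: "(\<lambda>(x, y, z). x) \<in> polyfun3"
| coord_y: "(\<lambda>(x, y, z). y) \<in> polyfun3"
| coord_z: "(\<lambda>(x, y, z). z) \<in> polyfun3"
| add: "P \<in> polyfun3 \<Longrightarrow> Q \<in> polyfun3 \<Longrightarrow> (\<lambda>q. P q + Q q) \<in> polyfun3"
| mult: "P \<in> polyfun3 \<Longrightarrow> Q \<in> polyfun3 \<Longrightarrow> (\<lambda>q. P q * Q q) \<in> polyfun3"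

text \<open>The coordinate ring of the surface, realised as the ring of restrictions of polynomial
  functions, that is, as the polynomial ring modulo the polynomials vanishing on the surface.
  Outside the surface all its elements take the value \<^const>\<open>undefined\<close>.\<close>

definition coord_ring :: "complex poly \<Rightarrow> (point \<Rightarrow> complex) set" where
  "coord_ring p = (\<lambda>P. restrict P (danielewski p)) ` polyfun3"

type_synonym vfield = "(point \<Rightarrow> complex) \<Rightarrow> (point \<Rightarrow> complex)"

text \<open>The derivations, over the complex numbers, of the coordinate ring.\<close>

definition poly_vfields :: "complex poly \<Rightarrow> vfield set" where
  "poly_vfields p = {D \<in> coord_ring p \<rightarrow>\<^sub>E coord_ring p.
     (\<forall>f\<in>coord_ring p. \<forall>g\<in>coord_ring p.
        D (\<lambda>q\<in>danielewski p. f q + g q) = (\<lambda>q\<in>danielewski p. D f q + D g q)) \<and>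
     (\<forall>c. \<forall>f\<in>coord_ring p.
        D (\<lambda>q\<in>danielewski p. c * f q) = (\<lambda>q\<in>danielewski p. c * D f q)) \<and>
     (\<forall>f\<in>coord_ring p. \<forall>g\<in>coord_ring p.
        D (\<lambda>q\<in>danielewski p. f q * g q) = (\<lambda>q\<in>danielewski p. f q * D g q + g q * D f q))}"

definition vf_zero :: "complex poly \<Rightarrow> vfield" where
  "vf_zero p = (\<lambda>f\<in>coord_ring p. \<lambda>q\<in>danielewski p. 0)"

definition vf_add :: "complex poly \<Rightarrow> vfield \<Rightarrow> vfield \<Rightarrow> vfield" where
  "vf_add p D E = (\<lambda>f\<in>coord_ring p. \<lambda>q\<in>danielewski p. D f q + E f q)"

definition vf_mult :: "complex poly \<Rightarrow> (point \<Rightarrow> complex) \<Rightarrow> vfield \<Rightarrow> vfield" where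
  "vf_mult p h D = (\<lambda>f\<in>coord_ring p. \<lambda>q\<in>danielewski p. h q * D f q)"

definition lie_bracket :: "complex poly \<Rightarrow> vfield \<Rightarrow> vfield \<Rightarrow> vfield" where
  "lie_bracket p D E = (\<lambda>f\<in>coord_ring p. \<lambda>q\<in>danielewski p. D (E f) q - E (D f) q)"

inductive_set lie_generated :: "complex poly \<Rightarrow> vfield set \<Rightarrow> vfield set"
  for p :: "complex poly" and S :: "vfield set" where
  generator: "D \<in> S \<Longrightarrow> D \<in> lie_generated p S"
| zero: "vf_zero p \<in> lie_generated p S"
| add: "D \<in> lie_generated p S \<Longrightarrow> E \<in> lie_generated p S \<Longrightarrow> vf_add p D E \<in> lie_generated p S"
| scale: "D \<in> lie_generated p S \<Longrightarrow> vf_mult p (\<lambda>_. c) D \<in> lie_generated p S"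
| bracket: "D \<in> lie_generated p S \<Longrightarrow> E \<in> lie_generated p S \<Longrightarrow>
    lie_bracket p D E \<in> lie_generated p S"

text \<open>Flow for all complex times. Applied to the coordinate functions, the last condition says that
  every curve \<open>t \<mapsto> \<phi> t q\<close> is an entire integral curve of the field.\<close>

definition complete_vfield :: "complex poly \<Rightarrow> vfield \<Rightarrow> bool" where
  "complete_vfield p D \<longleftrightarrow> (\<exists>\<phi> :: complex \<Rightarrow> point \<Rightarrow> point. \<forall>q\<in>danielewski p.
     \<phi> 0 q = q \<and>
     (\<forall>t. \<phi> t q \<in> danielewski p \<and>
        (\<forall>f\<in>coord_ring p. ((\<lambda>s. f (\<phi> s q)) has_field_derivative D f (\<phi> t q)) (at t))))"

definition apply_field ::
    "(point \<Rightarrow> complex) \<Rightarrow> (point \<Rightarrow> complex) \<Rightarrow> (point \<Rightarrow> complex) \<Rightarrow> (point \<Rightarrow> complex) \<Rightarrow> point \<Rightarrow> complex"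
  where
  "apply_field a b c P = (\<lambda>(x, y, z).
     a (x, y, z) * deriv (\<lambda>s. P (s, y, z)) x +
     b (x, y, z) * deriv (\<lambda>s. P (x, s, z)) y +
     c (x, y, z) * deriv (\<lambda>s. P (x, y, s)) z)"

text \<open>The field \<open>a \<partial>/\<partial>x + b \<partial>/\<partial>y + c \<partial>/\<partial>z\<close> acting on regular functions: apply it to a polynomial
  extension and restrict. For fields tangent to the surface the choice of the extension does
  not matter, see \<open>restrict_field_eq\<close> below.\<close>

definition restrict_field ::
    "complex poly \<Rightarrow> (point \<Rightarrow> complex) \<Rightarrow> (point \<Rightarrow> complex) \<Rightarrow> (point \<Rightarrow> complex) \<Rightarrow> vfield" where
  "restrict_field p a b c = (\<lambda>f\<in>coord_ring p.
     restrict (apply_field a b c (SOME P. P \<in> polyfun3 \<and> restrict P (danielewski p) = f))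
       (danielewski p))"

definition field_V :: "complex poly \<Rightarrow> vfield" where
  "field_V p = restrict_field p (\<lambda>(x, y, z). poly (pderiv p) z) (\<lambda>_. 0) (\<lambda>(x, y, z). y)"

definition field_W :: "complex poly \<Rightarrow> vfield" where
  "field_W p = restrict_field p (\<lambda>_. 0) (\<lambda>(x, y, z). poly (pderiv p) z) (\<lambda>(x, y, z). x)"

definition field_H :: "complex poly \<Rightarrow> vfield" where
  "field_H p = restrict_field p (\<lambda>(x, y, z). - x) (\<lambda>(x, y, z). y) (\<lambda>_. 0)"

definition z_mult :: "complex poly \<Rightarrow> vfield \<Rightarrow> vfield" where
  "z_mult p D = vf_mult p (\<lambda>(x, y, z). z) D"

definition total_deriv ::
    "(point \<Rightarrow> complex) \<Rightarrow> (point \<Rightarrow> complex) \<Rightarrow> (point \<Rightarrow> complex) \<Rightarrow> (point \<Rightarrow> complex) \<Rightarrow> bool" where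
  "total_deriv P A B C \<longleftrightarrow> (\<forall>u v w u' v' w' t.
    (u has_field_derivative u') (at t) \<longrightarrow> (v has_field_derivative v') (at t) \<longrightarrow>
    (w has_field_derivative w') (at t) \<longrightarrow>
    ((\<lambda>s. P (u s, v s, w s)) has_field_derivative
      (A (u t, v t, w t) * u' + B (u t, v t, w t) * v' + C (u t, v t, w t) * w')) (at t))"

lemma total_derivD:
  assumes "total_deriv P A B C" "(u has_field_derivative u') (at t)"
    "(v has_field_derivative v') (at t)" "(w has_field_derivative w') (at t)"
  shows "((\<lambda>s. P (u s, v s, w s)) has_field_derivative
      (A (u t, v t, w t) * u' + B (u t, v t, w t) * v' + C (u t, v t, w t) * w')) (at t)"
  using assms unfolding total_deriv_def by blast

lemma total_deriv_const: "total_deriv (\<lambda>_. c) (\<lambda>_. 0) (\<lambda>_. 0) (\<lambda>_. 0)"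
  by (simp add: total_deriv_def)

lemma total_deriv_add:
  assumes "total_deriv P A B C" "total_deriv Q A' B' C'"
  shows "total_deriv (\<lambda>q. P q + Q q) (\<lambda>q. A q + A' q) (\<lambda>q. B q + B' q) (\<lambda>q. C q + C' q)"
  unfolding total_deriv_def
  by (intro allI impI, rule DERIV_cong, rule DERIV_add[OF assms[THEN total_derivD]], assumption+)
     (simp add: algebra_simps)

lemma total_deriv_mult:
  assumes "total_deriv P A B C" "total_deriv Q A' B' C'"
  shows "total_deriv (\<lambda>q. P q * Q q) (\<lambda>q. A q * Q q + A' q * P q)
    (\<lambda>q. B q * Q q + B' q * P q) (\<lambda>q. C q * Q q + C' q * P q)"
  unfolding total_deriv_def
  by (intro allI impI, rule DERIV_cong, rule DERIV_mult[OF assms[THEN total_derivD]], assumption+)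
     (simp add: algebra_simps)

lemma polyfun3_total_deriv:
  assumes "P \<in> polyfun3"
  shows "\<exists>A\<in>polyfun3. \<exists>B\<in>polyfun3. \<exists>C\<in>polyfun3. total_deriv P A B C"
  using assms
proof induction
  case (const c)
  then show ?case using total_deriv_const polyfun3.const by blast
next
  case coord_x
  have "total_deriv (\<lambda>(x, y, z). x) (\<lambda>_. 1) (\<lambda>_. 0) (\<lambda>_. 0)" by (simp add: total_deriv_def)
  then show ?case using polyfun3.const by blast
next
  case coord_y
  have "total_deriv (\<lambda>(x, y, z). y) (\<lambda>_. 0) (\<lambda>_. 1) (\<lambda>_. 0)" by (simp add: total_deriv_def)
  then show ?case using polyfun3.const by blast
next
  case coord_z
  have "total_deriv (\<lambda>(x, y, z). z) (\<lambda>_. 0) (\<lambda>_. 0) (\<lambda>_. 1)" by (simp add: total_deriv_def)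
  then show ?case using polyfun3.const by blast
next
  case (add P Q)
  then obtain A B C A' B' C' where
    "total_deriv P A B C" "A \<in> polyfun3" "B \<in> polyfun3" "C \<in> polyfun3"
    "total_deriv Q A' B' C'" "A' \<in> polyfun3" "B' \<in> polyfun3" "C' \<in> polyfun3" by blast
  note td = this
  show ?case
    by (rule bexI, rule bexI, rule bexI, rule total_deriv_add[OF td(1,5)])
      (intro polyfun3.add td)+
next
  case (mult P Q)
  then obtain A B C A' B' C' where
    "total_deriv P A B C" "A \<in> polyfun3" "B \<in> polyfun3" "C \<in> polyfun3"
    "total_deriv Q A' B' C'" "A' \<in> polyfun3" "B' \<in> polyfun3" "C' \<in> polyfun3" by blast
  note td = this
  show ?case
    by (rule bexI, rule bexI, rule bexI, rule total_deriv_mult[OF td(1,5)])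
      (intro polyfun3.add polyfun3.mult td mult.hyps)+
qed

lemma polyfun3_continuous: "P \<in> polyfun3 \<Longrightarrow> continuous_on UNIV P"
  by (induction rule: polyfun3.induct) (auto intro!: continuous_intros simp: case_prod_unfold)

lemma apply_field_total_deriv:
  assumes "total_deriv P A B C"
  shows "apply_field a b c P = (\<lambda>q. a q * A q + b q * B q + c q * C q)"
proof -
  have "deriv (\<lambda>s. P (s, y, z)) x = A (x, y, z)" for x y z
    using total_derivD[OF assms, of "\<lambda>s. s" 1 x "\<lambda>_. y" 0 "\<lambda>_. z" 0]
    by (auto intro!: DERIV_imp_deriv)
  moreover have "deriv (\<lambda>s. P (x, s, z)) y = B (x, y, z)" for x y z
    using total_derivD[OF assms, of "\<lambda>_. x" 0 y "\<lambda>s. s" 1 "\<lambda>_. z" 0]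
    by (auto intro!: DERIV_imp_deriv)
  moreover have "deriv (\<lambda>s. P (x, y, s)) z = C (x, y, z)" for x y z
    using total_derivD[OF assms, of "\<lambda>_. x" 0 z "\<lambda>_. y" 0 "\<lambda>s. s" 1]
    by (auto intro!: DERIV_imp_deriv)
  ultimately show ?thesis
    by (auto simp: apply_field_def fun_eq_iff)
qed

definition tangent_field ::
    "complex poly \<Rightarrow> (point \<Rightarrow> complex) \<Rightarrow> (point \<Rightarrow> complex) \<Rightarrow> (point \<Rightarrow> complex) \<Rightarrow> bool" where
  "tangent_field p a b c \<longleftrightarrow> (\<forall>(x, y, z)\<in>danielewski p.
     y * a (x, y, z) + x * b (x, y, z) = poly (pderiv p) z * c (x, y, z))"

lemma apply_field_vanishes:
  assumes P: "P \<in> polyfun3" and van: "\<And>q. q \<in> danielewski p \<Longrightarrow> P q = 0"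
    and abc: "continuous_on UNIV a" "continuous_on UNIV b" "continuous_on UNIV c"
    and tan: "tangent_field p a b c" and q: "q \<in> danielewski p"
  shows "apply_field a b c P q = 0"
proof -
  obtain A B C where ABC: "A \<in> polyfun3" "B \<in> polyfun3" "C \<in> polyfun3"
    and td: "total_deriv P A B C"
    using polyfun3_total_deriv[OF P] by blast
  note ap = apply_field_total_deriv[OF td] and d = total_derivD[OF td]
  have curve: "A (u t, v t, w t) * u' + B (u t, v t, w t) * v' + C (u t, v t, w t) * w' = 0"
    if "(u has_field_derivative u') (at t)" "(v has_field_derivative v') (at t)"
       "(w has_field_derivative w') (at t)"
       "eventually (\<lambda>s. (u s, v s, w s) \<in> danielewski p) (nhds t)" for u v w u' v' w' t
  proof -
    have "eventually (\<lambda>s. P (u s, v s, w s) = 0) (nhds t)"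
      using that(4) by eventually_elim (rule van)
    then have "((\<lambda>s. P (u s, v s, w s)) has_field_derivative 0) (at t)"
      using DERIV_cong_ev[OF refl, of "\<lambda>s. P (u s, v s, w s)" "\<lambda>_. 0" t 0 0] by simp
    with d[OF that(1-3)] show ?thesis by (rule DERIV_unique)
  qed
  have ne: "eventually (\<lambda>s::complex. s \<noteq> 0) (nhds t)" if "t \<noteq> 0" for t
    using that by (intro t1_space_nhds)
  have x: "apply_field a b c P (x, y, z) = 0" if "x \<noteq> 0" "(x, y, z) \<in> danielewski p" for x y z
  proof -
    have y: "y = poly p z / x" using that by (auto simp: danielewski_def field_simps)
    have ev: "eventually (\<lambda>s. (s, poly p z / s, z) \<in> danielewski p) (nhds x)"
      by (rule eventually_mono[OF ne[OF that(1)]]) (simp add: danielewski_def)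
    have "A (x, y, z) * 1 + B (x, y, z) * (- poly p z / (x * x)) + C (x, y, z) * 0 = 0"
      unfolding y using that(1)
      by (intro curve[of "\<lambda>s. s" _ x "\<lambda>s. poly p z / s" _ "\<lambda>_. z"])
         (use ev in \<open>auto intro!: derivative_eq_intros\<close>)
    then have e1: "A (x, y, z) * x = B (x, y, z) * y"
      using that(1) unfolding y by (simp add: field_simps)
    have "A (x, y, z) * 0 + B (x, y, z) * (poly (pderiv p) z / x) + C (x, y, z) * 1 = 0"
      unfolding y using that(1)
      by (intro curve[of "\<lambda>_. x" _ z "\<lambda>s. poly p s / x" _ "\<lambda>s. s"])
         (auto intro!: derivative_eq_intros simp: danielewski_def)
    then have e2: "C (x, y, z) * x = - (B (x, y, z) * poly (pderiv p) z)"
      using that(1) by (simp add: field_simps eq_neg_iff_add_eq_0)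
    have "x * apply_field a b c P (x, y, z) =
        a (x, y, z) * (A (x, y, z) * x) + x * b (x, y, z) * B (x, y, z) + c (x, y, z) * (C (x, y, z) * x)"
      by (simp add: ap algebra_simps)
    also have "\<dots> = B (x, y, z) * (y * a (x, y, z) + x * b (x, y, z) - poly (pderiv p) z * c (x, y, z))"
      unfolding e1 e2 by (simp add: algebra_simps)
    also have "\<dots> = 0" using tan that(2) by (auto simp: tangent_field_def)
    finally show ?thesis using that(1) by simp
  qed
  have y: "apply_field a b c P (x, y, z) = 0" if "y \<noteq> 0" "(x, y, z) \<in> danielewski p" for x y z
  proof -
    have x: "x = poly p z / y" using that by (auto simp: danielewski_def field_simps)
    have ev: "eventually (\<lambda>s. (poly p z / s, s, z) \<in> danielewski p) (nhds y)"
      by (rule eventually_mono[OF ne[OF that(1)]]) (simp add: danielewski_def)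
    have "A (x, y, z) * (- poly p z / (y * y)) + B (x, y, z) * 1 + C (x, y, z) * 0 = 0"
      unfolding x using that(1)
      by (intro curve[of "\<lambda>s. poly p z / s" _ y "\<lambda>s. s" _ "\<lambda>_. z"])
         (use ev in \<open>auto intro!: derivative_eq_intros\<close>)
    then have e1: "B (x, y, z) * y = A (x, y, z) * x"
      using that(1) unfolding x by (simp add: field_simps)
    have "A (x, y, z) * (poly (pderiv p) z / y) + B (x, y, z) * 0 + C (x, y, z) * 1 = 0"
      unfolding x using that(1)
      by (intro curve[of "\<lambda>s. poly p s / y" _ z "\<lambda>_. y" _ "\<lambda>s. s"])
         (auto intro!: derivative_eq_intros simp: danielewski_def)
    then have e2: "C (x, y, z) * y = - (A (x, y, z) * poly (pderiv p) z)"
      using that(1) by (simp add: field_simps eq_neg_iff_add_eq_0)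
    have "y * apply_field a b c P (x, y, z) =
        y * a (x, y, z) * A (x, y, z) + b (x, y, z) * (B (x, y, z) * y) + c (x, y, z) * (C (x, y, z) * y)"
      by (simp add: ap algebra_simps)
    also have "\<dots> = A (x, y, z) * (y * a (x, y, z) + x * b (x, y, z) - poly (pderiv p) z * c (x, y, z))"
      unfolding e1 e2 by (simp add: algebra_simps)
    also have "\<dots> = 0" using tan that(2) by (auto simp: tangent_field_def)
    finally show ?thesis using that(1) by simp
  qed
  obtain x0 y0 z0 where q0: "q = (x0, y0, z0)" by (cases q)
  consider "x0 \<noteq> 0" | "y0 \<noteq> 0" | "x0 = 0" "y0 = 0" by blast
  then show ?thesis
  proof cases
    case 3
    then have root: "poly p z0 = 0" using q q0 by (simp add: danielewski_def)
    then obtain r where r: "p = [:- z0, 1:] * r" by (metis poly_eq_0_iff_dvd dvdE)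
    define g where "g s = (s * poly r (z0 + s^2), s, z0 + s^2)" for s :: complex
    have on: "g s \<in> danielewski p" for s
      by (simp add: g_def danielewski_def r power2_eq_square algebra_simps)
    have E: "continuous_on UNIV (apply_field a b c P)"
      unfolding ap by (intro continuous_intros abc polyfun3_continuous ABC)
    have "continuous_on UNIV g" unfolding g_def by (intro continuous_intros)
    then have "continuous_on UNIV (\<lambda>s. apply_field a b c P (g s))"
      by (rule continuous_on_compose2[OF E]) auto
    then have "isCont (\<lambda>s. apply_field a b c P (g s)) 0"
      by (simp add: continuous_on_eq_continuous_at)
    then have lim: "((\<lambda>s. apply_field a b c P (g s)) \<longlongrightarrow> apply_field a b c P (g 0)) (at 0)"
      by (simp add: isCont_def)
    have "apply_field a b c P (g s) = 0" if "s \<noteq> 0" for s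
      using y[OF that] on[of s] by (simp add: g_def)
    then have "((\<lambda>s. apply_field a b c P (g s)) \<longlongrightarrow> 0) (at 0)"
      by (intro tendsto_eventually) (auto simp: eventually_at_filter)
    with lim have "apply_field a b c P (g 0) = 0" by (rule LIM_unique)
    then show ?thesis using 3 q0 by (simp add: g_def)
  qed (use x y q q0 in auto)
qed

lemma restrict_field_eq:
  assumes P: "P \<in> polyfun3"
    and abc: "continuous_on UNIV a" "continuous_on UNIV b" "continuous_on UNIV c"
    and tan: "tangent_field p a b c"
  shows "restrict_field p a b c (restrict P (danielewski p)) =
    restrict (apply_field a b c P) (danielewski p)"
proof -
  define Q where "Q = (SOME Q. Q \<in> polyfun3 \<and> restrict Q (danielewski p) = restrict P (danielewski p))"
  have Q: "Q \<in> polyfun3" "restrict Q (danielewski p) = restrict P (danielewski p)"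
    using someI[of "\<lambda>Q. Q \<in> polyfun3 \<and> restrict Q (danielewski p) = restrict P (danielewski p)" P] P
    by (auto simp: Q_def)
  have "apply_field a b c Q q = apply_field a b c P q" if q: "q \<in> danielewski p" for q
  proof -
    define R where "R = (\<lambda>q. Q q + (- 1) * P q)"
    have R: "R \<in> polyfun3" unfolding R_def by (intro polyfun3.add polyfun3.mult polyfun3.const Q P)
    have "R q = 0" if "q \<in> danielewski p" for q
      using fun_cong[OF Q(2), of q] that by (simp add: R_def)
    then have 0: "apply_field a b c R q = 0"
      using apply_field_vanishes[OF R _ abc tan q] by blast
    obtain A B C where td1: "total_deriv Q A B C"
      using polyfun3_total_deriv[OF Q(1)] by blast
    obtain A' B' C' where td2: "total_deriv P A' B' C'"
      using polyfun3_total_deriv[OF P] by blast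
    show ?thesis
      using 0 unfolding R_def
        apply_field_total_deriv[OF total_deriv_add[OF td1 total_deriv_mult[OF total_deriv_const td2]]]
        apply_field_total_deriv[OF td1] apply_field_total_deriv[OF td2]
      by (simp add: algebra_simps)
  qed
  then have "restrict (apply_field a b c Q) (danielewski p) =
      restrict (apply_field a b c P) (danielewski p)"
    by (rule restrict_ext)
  moreover have "restrict P (danielewski p) \<in> coord_ring p"
    using P by (auto simp: coord_ring_def)
  ultimately show ?thesis
    by (simp add: restrict_field_def Q_def)
qed

lemma tangent_field_V: "tangent_field p (\<lambda>(x, y, z). poly (pderiv p) z) (\<lambda>_. 0) (\<lambda>(x, y, z). y)"
  and tangent_field_W: "tangent_field p (\<lambda>_. 0) (\<lambda>(x, y, z). poly (pderiv p) z) (\<lambda>(x, y, z). x)"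
  and tangent_field_H: "tangent_field p (\<lambda>(x, y, z). - x) (\<lambda>(x, y, z). y) (\<lambda>_. 0)"
  by (auto simp: tangent_field_def)

end

theory Submission
  imports Defs "HOL-Computational_Algebra.Polynomial_Factorial"
  "HOL-Computational_Algebra.Fundamental_Theorem_Algebra" "HOL-Computational_Algebra.Field_as_Ring"
begin

text \<open>
  Each of the six fields has an explicit flow. Every bracket needed has one factor of the form
  \<open>h H\<close>. First, \<open>[zH, V] = zV - yH\<close> gives \<open>yH\<close>, and further brackets with \<open>zH\<close> give \<open>f(z) yH\<close> and
  \<open>f(z) V\<close> for all polynomials \<open>f\<close>; symmetrically one obtains \<open>f xH\<close> and \<open>f W\<close>. Now
  \<open>[f yH, xH] = - 2 f p H\<close>, while \<open>[f xH, V] + [f yH, W]\<close> equals \<open>- 3 f p' H\<close> up to a multiple of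
  \<open>p H\<close>, because \<open>xV - yW = - p' H\<close>. As \<open>p\<close> has simple zeros, \<open>u p + v p' = 1\<close> for some \<open>u\<close>, \<open>v\<close>,
  and so all \<open>f H\<close> are generated. Induction on \<open>j\<close> with
  \<open>[f y^j H, g V] = f g y^j V - f' g y^(j+1) H\<close> yields all powers of \<open>y\<close>, likewise those of \<open>x\<close>, and
  hence all regular multiples of \<open>V\<close>, \<open>W\<close>, \<open>H\<close>. The same Bezout identity shows that these three
  fields span the module of derivations.
\<close>

section \<open>Derivations of the coordinate ring\<close>

lemma polyfun3_poly_z: "(\<lambda>(x, y, z). poly f z) \<in> polyfun3"
proof (induction f)
  case 0
  then show ?case using polyfun3.const[of 0] by (simp add: case_prod_unfold)
next
  case (pCons a f)
  then show ?case
    using polyfun3.add[OF polyfun3.const[of a] polyfun3.mult[OF polyfun3.coord_z pCons.IH]]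
    by (simp add: case_prod_unfold)
qed

text \<open>The terms f(z) x^i y^j span the polynomial functions additively. Keeping the whole
  polynomial in z as one coefficient allows induction on f and the replacement of xy by
  p(z).\<close>

definition monofun :: "complex poly \<Rightarrow> nat \<Rightarrow> nat \<Rightarrow> point \<Rightarrow> complex" where
  "monofun f i j = (\<lambda>(x, y, z). poly f z * x ^ i * y ^ j)"

lemma monofun_apply [simp]: "monofun f i j (x, y, z) = poly f z * x ^ i * y ^ j"
  by (simp add: monofun_def)

lemma monofun_polyfun3 [simp, intro]: "monofun f i j \<in> polyfun3"
proof -
  have x: "(\<lambda>(x, y, z). x ^ i) \<in> polyfun3" for i
  proof (induction i)
    case 0
    then show ?case using polyfun3.const[of 1] by (simp add: case_prod_unfold)
  next
    case (Suc i)
    then show ?case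
      using polyfun3.mult[OF polyfun3.coord_x Suc.IH] by (simp add: case_prod_unfold)
  qed
  have y: "(\<lambda>(x, y, z). y ^ j) \<in> polyfun3" for j
  proof (induction j)
    case 0
    then show ?case using polyfun3.const[of 1] by (simp add: case_prod_unfold)
  next
    case (Suc i)
    then show ?case
      using polyfun3.mult[OF polyfun3.coord_y Suc.IH] by (simp add: case_prod_unfold)
  qed
  show ?thesis
    using polyfun3.mult[OF polyfun3.mult[OF polyfun3_poly_z[of f] x[of i]] y[of j]]
    by (simp add: monofun_def case_prod_unfold)
qed

text \<open>At \<open>i = 0\<close> the truncated exponent \<open>i - 1\<close> does no harm, since
  the factor \<open>of_nat i\<close> vanishes; likewise for j.\<close>

lemma apply_field_monofun:
  "apply_field a b c (monofun f i j) (x, y, z) =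
     a (x, y, z) * (poly f z * (of_nat i * x ^ (i - 1)) * y ^ j) +
     b (x, y, z) * (poly f z * x ^ i * (of_nat j * y ^ (j - 1))) +
     c (x, y, z) * (poly (pderiv f) z * x ^ i * y ^ j)"
proof -
  have "deriv (\<lambda>s. monofun f i j (s, y, z)) x = poly f z * (of_nat i * x ^ (i - 1)) * y ^ j"
    by (rule DERIV_imp_deriv) (auto intro!: derivative_eq_intros)
  moreover have "deriv (\<lambda>s. monofun f i j (x, s, z)) y =
      poly f z * x ^ i * (of_nat j * y ^ (j - 1))"
    by (rule DERIV_imp_deriv) (auto intro!: derivative_eq_intros)
  moreover have "deriv (\<lambda>s. monofun f i j (x, y, s)) z = poly (pderiv f) z * x ^ i * y ^ j"
    by (rule DERIV_imp_deriv) (auto intro!: derivative_eq_intros)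
  ultimately show ?thesis by (simp add: apply_field_def)
qed

lemma apply_field_add:
  assumes "P \<in> polyfun3" "Q \<in> polyfun3"
  shows "apply_field a b c (\<lambda>q. P q + Q q) q = apply_field a b c P q + apply_field a b c Q q"
proof -
  obtain A B C A' B' C' where td: "total_deriv P A B C" "total_deriv Q A' B' C'"
    using assms[THEN polyfun3_total_deriv] by blast
  show ?thesis
    unfolding apply_field_total_deriv[OF total_deriv_add[OF td]] td[THEN apply_field_total_deriv]
    by (simp add: algebra_simps)
qed

lemma apply_field_mult:
  assumes "P \<in> polyfun3" "Q \<in> polyfun3"
  shows "apply_field a b c (\<lambda>q. P q * Q q) q =
    P q * apply_field a b c Q q + Q q * apply_field a b c P q"
proof -
  obtain A B C A' B' C' where td: "total_deriv P A B C" "total_deriv Q A' B' C'"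
    using assms[THEN polyfun3_total_deriv] by blast
  show ?thesis
    unfolding apply_field_total_deriv[OF total_deriv_mult[OF td]] td[THEN apply_field_total_deriv]
    by (simp add: algebra_simps)
qed

lemma apply_field_const: "apply_field a b c (\<lambda>_. k) q = 0"
  by (simp add: apply_field_def case_prod_unfold)

lemma apply_field_coord:
  "apply_field a b c (\<lambda>(x, y, z). x) q = a q"
  "apply_field a b c (\<lambda>(x, y, z). y) q = b q"
  "apply_field a b c (\<lambda>(x, y, z). z) q = c q"
  by (cases q; simp add: apply_field_def)+

lemma apply_field_polyfun3:
  assumes "P \<in> polyfun3" "a \<in> polyfun3" "b \<in> polyfun3" "c \<in> polyfun3"
  shows "apply_field a b c P \<in> polyfun3"
proof -
  obtain A B C where td: "total_deriv P A B C" "A \<in> polyfun3" "B \<in> polyfun3" "C \<in> polyfun3"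
    using polyfun3_total_deriv[OF assms(1)] by blast
  show ?thesis
    unfolding apply_field_total_deriv[OF td(1)] by (intro polyfun3.intros assms td)
qed

lemma restrict_in_coord_ring [simp, intro]:
  "P \<in> polyfun3 \<Longrightarrow> restrict P (danielewski p) \<in> coord_ring p"
  by (simp add: coord_ring_def)

lemma coord_ringE:
  assumes "f \<in> coord_ring p"
  obtains P where "P \<in> polyfun3" "f = restrict P (danielewski p)"
  using assms by (auto simp: coord_ring_def)

lemma coord_ring_add:
  assumes "f \<in> coord_ring p" "g \<in> coord_ring p"
  shows "(\<lambda>q\<in>danielewski p. f q + g q) \<in> coord_ring p"
proof -
  obtain P Q where PQ: "P \<in> polyfun3" "Q \<in> polyfun3"
    "f = restrict P (danielewski p)" "g = restrict Q (danielewski p)"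
    using assms by (meson coord_ringE)
  then have "(\<lambda>q\<in>danielewski p. f q + g q) = restrict (\<lambda>q. P q + Q q) (danielewski p)"
    by (auto intro!: restrict_ext)
  then show ?thesis using restrict_in_coord_ring[OF polyfun3.add[OF PQ(1,2)]] by simp
qed

lemma coord_ring_mult:
  assumes "f \<in> coord_ring p" "g \<in> coord_ring p"
  shows "(\<lambda>q\<in>danielewski p. f q * g q) \<in> coord_ring p"
proof -
  obtain P Q where PQ: "P \<in> polyfun3" "Q \<in> polyfun3"
    "f = restrict P (danielewski p)" "g = restrict Q (danielewski p)"
    using assms by (meson coord_ringE)
  then have "(\<lambda>q\<in>danielewski p. f q * g q) = restrict (\<lambda>q. P q * Q q) (danielewski p)"
    by (auto intro!: restrict_ext)
  then show ?thesis using restrict_in_coord_ring[OF polyfun3.mult[OF PQ(1,2)]] by simp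
qed

lemma coord_ring_const: "(\<lambda>q\<in>danielewski p. c) \<in> coord_ring p"
  by (intro restrict_in_coord_ring polyfun3.const)

lemma coord_ring_scale: "f \<in> coord_ring p \<Longrightarrow> (\<lambda>q\<in>danielewski p. c * f q) \<in> coord_ring p"
  using coord_ring_mult[OF coord_ring_const[of c p]] by (simp cong: restrict_cong)

lemma coord_ring_diff:
  assumes "f \<in> coord_ring p" "g \<in> coord_ring p"
  shows "(\<lambda>q\<in>danielewski p. f q - g q) \<in> coord_ring p"
  using coord_ring_add[OF assms(1) coord_ring_scale[OF assms(2), of "- 1"]]
  by (simp cong: restrict_cong)

lemma poly_vfieldsI:
  assumes "D \<in> extensional (coord_ring p)"
    and "\<And>f. f \<in> coord_ring p \<Longrightarrow> D f \<in> coord_ring p"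
    and "\<And>f g. f \<in> coord_ring p \<Longrightarrow> g \<in> coord_ring p \<Longrightarrow>
      D (\<lambda>q\<in>danielewski p. f q + g q) = (\<lambda>q\<in>danielewski p. D f q + D g q)"
    and "\<And>c f. f \<in> coord_ring p \<Longrightarrow>
      D (\<lambda>q\<in>danielewski p. c * f q) = (\<lambda>q\<in>danielewski p. c * D f q)"
    and "\<And>f g. f \<in> coord_ring p \<Longrightarrow> g \<in> coord_ring p \<Longrightarrow>
      D (\<lambda>q\<in>danielewski p. f q * g q) = (\<lambda>q\<in>danielewski p. f q * D g q + g q * D f q)"
  shows "D \<in> poly_vfields p"
  using assms unfolding poly_vfields_def PiE_def by blast

lemma poly_vfieldsD:
  assumes "D \<in> poly_vfields p"
  shows "D \<in> extensional (coord_ring p)"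
    and "\<And>f. f \<in> coord_ring p \<Longrightarrow> D f \<in> coord_ring p"
    and "\<And>f g. f \<in> coord_ring p \<Longrightarrow> g \<in> coord_ring p \<Longrightarrow>
      D (\<lambda>q\<in>danielewski p. f q + g q) = (\<lambda>q\<in>danielewski p. D f q + D g q)"
    and "\<And>c f. f \<in> coord_ring p \<Longrightarrow>
      D (\<lambda>q\<in>danielewski p. c * f q) = (\<lambda>q\<in>danielewski p. c * D f q)"
    and "\<And>f g. f \<in> coord_ring p \<Longrightarrow> g \<in> coord_ring p \<Longrightarrow>
      D (\<lambda>q\<in>danielewski p. f q * g q) = (\<lambda>q\<in>danielewski p. f q * D g q + g q * D f q)"
  using assms unfolding poly_vfields_def PiE_def by blast+

text \<open>Needed because equality of vector fields is equality of total functions, while all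
  computations take place on the surface.\<close>

lemma poly_vfields_outside:
  assumes "D \<in> poly_vfields p" "f \<in> coord_ring p" "q \<notin> danielewski p"
  shows "D f q = undefined"
  using poly_vfieldsD(2)[OF assms(1,2)] assms(3) by (auto simp: coord_ring_def)

text \<open>A derivation is determined by its values on the coordinates, as these and the constants
  generate the ring: both sides are additive and obey the product rule.\<close>

lemma poly_vfields_chain_rule:
  assumes D: "D \<in> poly_vfields p" and P: "P \<in> polyfun3" and q: "q \<in> danielewski p"
  shows "D (restrict P (danielewski p)) q =
    apply_field (D (restrict (\<lambda>(x, y, z). x) (danielewski p)))
      (D (restrict (\<lambda>(x, y, z). y) (danielewski p)))
      (D (restrict (\<lambda>(x, y, z). z) (danielewski p))) P q"
  using P
proof induction
  case (const c)
  \<comment> \<open>The product rule for 1 * 1 = 1 forces D 1 = 0; linearity then handles every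
    constant.\<close>
  have "D (\<lambda>q\<in>danielewski p. 1) q = 2 * D (\<lambda>q\<in>danielewski p. 1) q"
    using fun_cong[OF poly_vfieldsD(5)[OF D coord_ring_const[of 1] coord_ring_const[of 1]], of q] q
    by (simp cong: restrict_cong)
  then have "D (\<lambda>q\<in>danielewski p. 1) q = 0" by simp
  moreover have "D (\<lambda>q\<in>danielewski p. c) q = c * D (\<lambda>q\<in>danielewski p. 1) q"
    using fun_cong[OF poly_vfieldsD(4)[OF D coord_ring_const[of 1], of c], of q] q
    by (simp cong: restrict_cong)
  ultimately show ?case unfolding apply_field_const by (metis mult_zero_right)
next
  case coord_x
  show ?case unfolding apply_field_coord ..
next
  case coord_y
  show ?case unfolding apply_field_coord ..
next
  case coord_z
  show ?case unfolding apply_field_coord ..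
next
  case (add P Q)
  have "D (restrict (\<lambda>q. P q + Q q) (danielewski p)) q =
      D (restrict P (danielewski p)) q + D (restrict Q (danielewski p)) q"
    using fun_cong[OF poly_vfieldsD(3)[OF D add.hyps[THEN restrict_in_coord_ring]], of q] q
    by (simp cong: restrict_cong)
  then show ?case unfolding add.IH apply_field_add[OF add.hyps] .
next
  case (mult P Q)
  have "D (restrict (\<lambda>q. P q * Q q) (danielewski p)) q =
      P q * D (restrict Q (danielewski p)) q + Q q * D (restrict P (danielewski p)) q"
    using fun_cong[OF poly_vfieldsD(5)[OF D mult.hyps[THEN restrict_in_coord_ring]], of q] q
    by (simp cong: restrict_cong)
  then show ?case unfolding mult.IH apply_field_mult[OF mult.hyps] .
qed

lemma poly_vfields_eqI:
  assumes D: "D \<in> poly_vfields p" and E: "E \<in> poly_vfields p"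
    and "\<And>x y z. (x, y, z) \<in> danielewski p \<Longrightarrow>
      D (restrict (\<lambda>(x, y, z). x) (danielewski p)) (x, y, z) =
      E (restrict (\<lambda>(x, y, z). x) (danielewski p)) (x, y, z)"
    and "\<And>x y z. (x, y, z) \<in> danielewski p \<Longrightarrow>
      D (restrict (\<lambda>(x, y, z). y) (danielewski p)) (x, y, z) =
      E (restrict (\<lambda>(x, y, z). y) (danielewski p)) (x, y, z)"
    and "\<And>x y z. (x, y, z) \<in> danielewski p \<Longrightarrow>
      D (restrict (\<lambda>(x, y, z). z) (danielewski p)) (x, y, z) =
      E (restrict (\<lambda>(x, y, z). z) (danielewski p)) (x, y, z)"
  shows "D = E"
proof (rule extensionalityI[OF D[THEN poly_vfieldsD(1)] E[THEN poly_vfieldsD(1)]])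
  fix f assume f: "f \<in> coord_ring p"
  then obtain P where P: "P \<in> polyfun3" "f = restrict P (danielewski p)" by (rule coord_ringE)
  show "D f = E f"
  proof
    fix q
    show "D f q = E f q"
    proof (cases "q \<in> danielewski p")
      case True
      then show ?thesis
        unfolding P(2) poly_vfields_chain_rule[OF D P(1) True]
          poly_vfields_chain_rule[OF E P(1) True]
        using assms(3-5) by (cases q) (simp add: apply_field_def)
    qed (use D E f in \<open>simp add: poly_vfields_outside\<close>)
  qed
qed

section \<open>The Lie algebra of polynomial vector fields\<close>

lemma vf_zero_in: "vf_zero p \<in> poly_vfields p"
  by (rule poly_vfieldsI)
    (auto simp: vf_zero_def coord_ring_const coord_ring_add coord_ring_scale coord_ring_mult
      intro!: restrict_ext)

lemma vf_add_in:
  assumes D: "D \<in> poly_vfields p" and E: "E \<in> poly_vfields p"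
  shows "vf_add p D E \<in> poly_vfields p"
  by (rule poly_vfieldsI)
    (auto simp: vf_add_def coord_ring_add coord_ring_scale coord_ring_mult poly_vfieldsD[OF D]
      poly_vfieldsD[OF E] algebra_simps intro!: restrict_ext)

lemma vf_mult_in:
  assumes D: "D \<in> poly_vfields p" and P: "P \<in> polyfun3"
  shows "vf_mult p P D \<in> poly_vfields p"
proof (rule poly_vfieldsI)
  fix f assume f: "f \<in> coord_ring p"
  show "vf_mult p P D f \<in> coord_ring p"
    using coord_ring_mult[OF restrict_in_coord_ring[OF P] poly_vfieldsD(2)[OF D f]] f
    by (simp add: vf_mult_def cong: restrict_cong)
qed (auto simp: vf_mult_def coord_ring_add coord_ring_scale coord_ring_mult poly_vfieldsD[OF D]
      algebra_simps intro!: restrict_ext)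

lemma lie_bracket_in:
  assumes D: "D \<in> poly_vfields p" and E: "E \<in> poly_vfields p"
  shows "lie_bracket p D E \<in> poly_vfields p"
proof (rule poly_vfieldsI)
  fix f g assume f: "f \<in> coord_ring p" and g: "g \<in> coord_ring p"
  have br: "lie_bracket p D E h = (\<lambda>q\<in>danielewski p. D (E h) q - E (D h) q)"
    if "h \<in> coord_ring p" for h
    using that by (simp add: lie_bracket_def)
  \<comment> \<open>Expansion of F (G (f g)). The cross terms F f * G g + G f * F g are symmetric in
    F and G, so they cancel in the commutator.\<close>
  have sum: "F (\<lambda>q\<in>danielewski p. f q * G g q + g q * G f q) q =
      f q * F (G g) q + G g q * F f q + (g q * F (G f) q + G f q * F g q)"
    if F: "F \<in> poly_vfields p" and G: "G \<in> poly_vfields p" and q: "q \<in> danielewski p" for F G q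
  proof -
    note Gfg = poly_vfieldsD(2)[OF G f] poly_vfieldsD(2)[OF G g]
    \<comment> \<open>The summands are restricted separately, since additivity of F is stated for
      elements of the coordinate ring.\<close>
    have "(\<lambda>q\<in>danielewski p. f q * G g q + g q * G f q) =
        (\<lambda>q\<in>danielewski p. (\<lambda>q\<in>danielewski p. f q * G g q) q +
          (\<lambda>q\<in>danielewski p. g q * G f q) q)"
      by (auto intro!: restrict_ext)
    then have "F (\<lambda>q\<in>danielewski p. f q * G g q + g q * G f q) q =
        F (\<lambda>q\<in>danielewski p. f q * G g q) q + F (\<lambda>q\<in>danielewski p. g q * G f q) q"
      using q by (simp only: poly_vfieldsD(3)[OF F coord_ring_mult[OF f Gfg(2)]
          coord_ring_mult[OF g Gfg(1)]] restrict_apply')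
    then show ?thesis
      using q by (simp add: poly_vfieldsD(5)[OF F f Gfg(2)] poly_vfieldsD(5)[OF F g Gfg(1)])
  qed
  show "lie_bracket p D E (\<lambda>q\<in>danielewski p. f q * g q) =
      (\<lambda>q\<in>danielewski p. f q * lie_bracket p D E g q + g q * lie_bracket p D E f q)"
    unfolding br[OF coord_ring_mult[OF f g]] poly_vfieldsD(5)[OF D f g] poly_vfieldsD(5)[OF E f g]
  proof (rule restrict_ext)
    fix q assume q: "q \<in> danielewski p"
    show "D (\<lambda>q\<in>danielewski p. f q * E g q + g q * E f q) q -
        E (\<lambda>q\<in>danielewski p. f q * D g q + g q * D f q) q =
        f q * lie_bracket p D E g q + g q * lie_bracket p D E f q"
      unfolding sum[OF D E q] sum[OF E D q] using q by (simp add: br f g algebra_simps)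
  qed
qed (auto simp: lie_bracket_def coord_ring_add coord_ring_scale coord_ring_diff
      poly_vfieldsD[OF D] poly_vfieldsD[OF E] algebra_simps intro!: restrict_ext)

text \<open>Tangency allows the chosen extension of a regular function to be replaced by any other
  one. Sums and products of extensions then reduce the derivation laws to those of
  \<open>apply_field\<close>.\<close>

lemma restrict_field_in:
  assumes abc: "a \<in> polyfun3" "b \<in> polyfun3" "c \<in> polyfun3" and tan: "tangent_field p a b c"
  shows "restrict_field p a b c \<in> poly_vfields p"
proof -
  have eq: "restrict_field p a b c (restrict P (danielewski p)) =
      restrict (apply_field a b c P) (danielewski p)" if "P \<in> polyfun3" for P
    using restrict_field_eq[OF that abc[THEN polyfun3_continuous] tan] .
  show ?thesis
  proof (rule poly_vfieldsI)
    fix f g assume "f \<in> coord_ring p" "g \<in> coord_ring p"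
    then obtain P Q where PQ: "P \<in> polyfun3" "Q \<in> polyfun3"
      and f: "f = restrict P (danielewski p)" and g: "g = restrict Q (danielewski p)"
      by (meson coord_ringE)
    have fg: "(\<lambda>q\<in>danielewski p. f q + g q) = restrict (\<lambda>q. P q + Q q) (danielewski p)"
      "(\<lambda>q\<in>danielewski p. f q * g q) = restrict (\<lambda>q. P q * Q q) (danielewski p)"
      by (auto simp: f g intro!: restrict_ext)
    show "restrict_field p a b c (\<lambda>q\<in>danielewski p. f q + g q) =
        (\<lambda>q\<in>danielewski p. restrict_field p a b c f q + restrict_field p a b c g q)"
      unfolding fg eq[OF polyfun3.add[OF PQ]]
      by (auto simp: eq PQ f g apply_field_add intro!: restrict_ext)
    show "restrict_field p a b c (\<lambda>q\<in>danielewski p. f q * g q) =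
        (\<lambda>q\<in>danielewski p. f q * restrict_field p a b c g q + g q * restrict_field p a b c f q)"
      unfolding fg eq[OF polyfun3.mult[OF PQ]]
      by (auto simp: eq PQ f g apply_field_mult intro!: restrict_ext)
  next
    fix k f assume "f \<in> coord_ring p"
    then obtain P where P: "P \<in> polyfun3" and f: "f = restrict P (danielewski p)"
      by (rule coord_ringE)
    show "restrict_field p a b c f \<in> coord_ring p"
      unfolding f eq[OF P] by (intro restrict_in_coord_ring apply_field_polyfun3 P abc)
    have kf: "(\<lambda>q\<in>danielewski p. k * f q) = restrict (\<lambda>q. k * P q) (danielewski p)"
      by (auto simp: f intro!: restrict_ext)
    show "restrict_field p a b c (\<lambda>q\<in>danielewski p. k * f q) =
        (\<lambda>q\<in>danielewski p. k * restrict_field p a b c f q)"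
      unfolding kf eq[OF polyfun3.mult[OF polyfun3.const P]]
      by (auto simp: eq P f apply_field_mult polyfun3.const apply_field_const
          intro!: restrict_ext)
  qed (simp add: restrict_field_def)
qed

section \<open>The fields V, W and H as derivations\<close>

lemma polyfun3_neg_x: "(\<lambda>(x, y, z). - x) \<in> polyfun3"
  using polyfun3.mult[OF polyfun3.const[of "- 1"] polyfun3.coord_x] by (simp add: case_prod_unfold)

lemma field_V_in: "field_V p \<in> poly_vfields p"
  unfolding field_V_def
  by (intro restrict_field_in tangent_field_V polyfun3_poly_z polyfun3.intros)

lemma field_W_in: "field_W p \<in> poly_vfields p"
  unfolding field_W_def
  by (intro restrict_field_in tangent_field_W polyfun3_poly_z polyfun3.intros)

lemma field_H_in: "field_H p \<in> poly_vfields p"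
  unfolding field_H_def
  by (intro restrict_field_in tangent_field_H polyfun3_neg_x polyfun3.intros)

lemma field_V_apply:
  assumes "P \<in> polyfun3" "q \<in> danielewski p"
  shows "field_V p (restrict P (danielewski p)) q =
    apply_field (\<lambda>(x, y, z). poly (pderiv p) z) (\<lambda>_. 0) (\<lambda>(x, y, z). y) P q"
  unfolding field_V_def using assms
  by (subst restrict_field_eq)
     (auto intro: tangent_field_V polyfun3_continuous polyfun3_poly_z polyfun3.intros)

lemma field_W_apply:
  assumes "P \<in> polyfun3" "q \<in> danielewski p"
  shows "field_W p (restrict P (danielewski p)) q =
    apply_field (\<lambda>_. 0) (\<lambda>(x, y, z). poly (pderiv p) z) (\<lambda>(x, y, z). x) P q"
  unfolding field_W_def using assms
  by (subst restrict_field_eq)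
     (auto intro: tangent_field_W polyfun3_continuous polyfun3_poly_z polyfun3.intros)

lemma field_H_apply:
  assumes "P \<in> polyfun3" "q \<in> danielewski p"
  shows "field_H p (restrict P (danielewski p)) q =
    apply_field (\<lambda>(x, y, z). - x) (\<lambda>(x, y, z). y) (\<lambda>_. 0) P q"
  unfolding field_H_def using assms
  by (subst restrict_field_eq)
     (auto intro: tangent_field_H polyfun3_continuous polyfun3_neg_x polyfun3.intros)

lemma field_V_coord:
  "field_V p (restrict (\<lambda>(x, y, z). x) (danielewski p)) =
    restrict (\<lambda>(x, y, z). poly (pderiv p) z) (danielewski p)"
  "field_V p (restrict (\<lambda>(x, y, z). y) (danielewski p)) = restrict (\<lambda>_. 0) (danielewski p)"
  "field_V p (restrict (\<lambda>(x, y, z). z) (danielewski p)) =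
    restrict (\<lambda>(x, y, z). y) (danielewski p)"
  by (rule ext, rename_tac q, case_tac "q \<in> danielewski p", case_tac q;
      simp add: field_V_apply polyfun3.intros apply_field_def
        poly_vfields_outside[OF field_V_in])+

lemma field_W_coord:
  "field_W p (restrict (\<lambda>(x, y, z). x) (danielewski p)) = restrict (\<lambda>_. 0) (danielewski p)"
  "field_W p (restrict (\<lambda>(x, y, z). y) (danielewski p)) =
    restrict (\<lambda>(x, y, z). poly (pderiv p) z) (danielewski p)"
  "field_W p (restrict (\<lambda>(x, y, z). z) (danielewski p)) =
    restrict (\<lambda>(x, y, z). x) (danielewski p)"
  by (rule ext, rename_tac q, case_tac "q \<in> danielewski p", case_tac q;
      simp add: field_W_apply polyfun3.intros apply_field_def
        poly_vfields_outside[OF field_W_in])+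

lemma field_H_coord:
  "field_H p (restrict (\<lambda>(x, y, z). x) (danielewski p)) =
    restrict (\<lambda>(x, y, z). - x) (danielewski p)"
  "field_H p (restrict (\<lambda>(x, y, z). y) (danielewski p)) =
    restrict (\<lambda>(x, y, z). y) (danielewski p)"
  "field_H p (restrict (\<lambda>(x, y, z). z) (danielewski p)) = restrict (\<lambda>_. 0) (danielewski p)"
  by (rule ext, rename_tac q, case_tac "q \<in> danielewski p", case_tac q;
      simp add: field_H_apply polyfun3.intros apply_field_def
        poly_vfields_outside[OF field_H_in])+

text \<open>H is the Euler field of the grading in which x, y, z have weights -1, 1, 0. For it V has
  weight 1 and W has weight -1.\<close>

lemma bracket_H_V: "lie_bracket p (field_H p) (field_V p) = field_V p"
  by (rule poly_vfields_eqI[OF lie_bracket_in[OF field_H_in field_V_in] field_V_in];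
      simp add: lie_bracket_def polyfun3.intros field_V_coord field_H_coord
        field_V_apply field_H_apply polyfun3_poly_z polyfun3_neg_x)
    (simp_all add: apply_field_def)

lemma bracket_H_W: "lie_bracket p (field_H p) (field_W p) = vf_mult p (\<lambda>_. - 1) (field_W p)"
  by (rule poly_vfields_eqI[OF lie_bracket_in[OF field_H_in field_W_in]
        vf_mult_in[OF field_W_in polyfun3.const]];
      simp add: lie_bracket_def vf_mult_def polyfun3.intros field_W_coord field_H_coord
        field_W_apply field_H_apply polyfun3_poly_z polyfun3_neg_x)
    (simp_all add: apply_field_def)

text \<open>Reduces a bracket of multiples to the bracket of the fields themselves and their action
  on the coefficients, by two uses of the product rule.\<close>

lemma bracket_vf_mult:
  assumes D: "D \<in> poly_vfields p" and E: "E \<in> poly_vfields p"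
    and P: "P \<in> polyfun3" and Q: "Q \<in> polyfun3"
    and f: "f \<in> coord_ring p" and q: "q \<in> danielewski p"
  shows "lie_bracket p (vf_mult p P D) (vf_mult p Q E) f q =
    P q * Q q * lie_bracket p D E f q +
    P q * D (restrict Q (danielewski p)) q * E f q -
    Q q * E (restrict P (danielewski p)) q * D f q"
proof -
  have "D (\<lambda>q\<in>danielewski p. Q q * E f q) q =
      Q q * D (E f) q + E f q * D (restrict Q (danielewski p)) q"
    using fun_cong[OF poly_vfieldsD(5)[OF D restrict_in_coord_ring[OF Q]
          poly_vfieldsD(2)[OF E f]], of q] q
    by (simp cong: restrict_cong)
  moreover have "E (\<lambda>q\<in>danielewski p. P q * D f q) q =
      P q * E (D f) q + D f q * E (restrict P (danielewski p)) q"
    using fun_cong[OF poly_vfieldsD(5)[OF E restrict_in_coord_ring[OF P]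
          poly_vfieldsD(2)[OF D f]], of q] q
    by (simp cong: restrict_cong)
  moreover have "(\<lambda>q\<in>danielewski p. Q q * E f q) \<in> coord_ring p"
    "(\<lambda>q\<in>danielewski p. P q * D f q) \<in> coord_ring p"
    using poly_vfieldsD(2)[OF vf_mult_in[OF E Q] f] poly_vfieldsD(2)[OF vf_mult_in[OF D P] f] f
    by (simp_all add: vf_mult_def)
  ultimately show ?thesis
    using f q by (simp add: lie_bracket_def vf_mult_def algebra_simps)
qed

section \<open>Completeness\<close>

text \<open>A flow need only be checked in the coordinates \<open>u\<close>, \<open>v\<close>,
  \<open>w\<close>: the chain rule for polynomial extensions carries the differential equation over
  to every regular function.\<close>

lemma complete_vfieldI:
  assumes D: "\<And>P q. P \<in> polyfun3 \<Longrightarrow> q \<in> danielewski p \<Longrightarrow>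
      D (restrict P (danielewski p)) q = apply_field a b c P q"
    and flow: "\<And>x y z t. (x, y, z) \<in> danielewski p \<Longrightarrow>
      u x y z 0 = x \<and> v x y z 0 = y \<and> w x y z 0 = z \<and>
      (u x y z t, v x y z t, w x y z t) \<in> danielewski p \<and>
      (u x y z has_field_derivative a (u x y z t, v x y z t, w x y z t)) (at t) \<and>
      (v x y z has_field_derivative b (u x y z t, v x y z t, w x y z t)) (at t) \<and>
      (w x y z has_field_derivative c (u x y z t, v x y z t, w x y z t)) (at t)"
  shows "complete_vfield p D"
proof -
  define \<phi> where "\<phi> t = (\<lambda>(x, y, z). (u x y z t, v x y z t, w x y z t))" for t
  have "((\<lambda>s. f (\<phi> s q)) has_field_derivative D f (\<phi> t q)) (at t)"
    if q: "q \<in> danielewski p" and f: "f \<in> coord_ring p" for q t f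
  proof -
    obtain x y z where xyz: "q = (x, y, z)" by (cases q)
    note fl = flow[OF q[unfolded xyz]]
    from f obtain P where P: "P \<in> polyfun3" and fP: "f = restrict P (danielewski p)"
      by (rule coord_ringE)
    obtain A B C where td: "total_deriv P A B C" using polyfun3_total_deriv[OF P] by blast
    have on: "\<phi> s q \<in> danielewski p" for s using fl by (simp add: \<phi>_def xyz)
    have "((\<lambda>s. P (u x y z s, v x y z s, w x y z s)) has_field_derivative
        apply_field a b c P (\<phi> t q)) (at t)"
      unfolding apply_field_total_deriv[OF td]
      by (rule DERIV_cong[OF total_derivD[OF td]]) (use fl in \<open>auto simp: \<phi>_def xyz\<close>)
    then show ?thesis
      using D[OF P on] on by (simp add: fP) (simp add: \<phi>_def xyz)
  qed
  moreover have "\<phi> 0 q = q" "\<phi> t q \<in> danielewski p" if "q \<in> danielewski p" for q t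
    using that flow by (cases q; simp add: \<phi>_def)+
  ultimately show ?thesis unfolding complete_vfield_def by blast
qed

lemma vf_mult_apply:
  assumes "\<And>P q. P \<in> polyfun3 \<Longrightarrow> q \<in> danielewski p \<Longrightarrow>
      D (restrict P (danielewski p)) q = apply_field a b c P q"
    and "P \<in> polyfun3" "q \<in> danielewski p"
  shows "vf_mult p h D (restrict P (danielewski p)) q =
    apply_field (\<lambda>q. h q * a q) (\<lambda>q. h q * b q) (\<lambda>q. h q * c q) P q"
  using assms by (cases q) (simp add: vf_mult_def apply_field_def algebra_simps)

text \<open>Along V the coordinate y is constant and z moves linearly. For nonzero y the surface
  equation then determines x; for y = 0 also z stays fixed and x moves linearly.\<close>

lemma complete_V: "complete_vfield p (field_V p)"
  by (rule complete_vfieldI[OF field_V_apply, of p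
        "\<lambda>x y z t. if y = 0 then x + t * poly (pderiv p) z else poly p (z + t * y) / y"
        "\<lambda>x y z t. y" "\<lambda>x y z t. z + t * y"])
    (auto simp: danielewski_def field_simps intro!: derivative_eq_intros)

lemma complete_W: "complete_vfield p (field_W p)"
  by (rule complete_vfieldI[OF field_W_apply, of p "\<lambda>x y z t. x"
        "\<lambda>x y z t. if x = 0 then y + t * poly (pderiv p) z else poly p (z + t * x) / x"
        "\<lambda>x y z t. z + t * x"])
    (auto simp: danielewski_def field_simps intro!: derivative_eq_intros)

lemma complete_H: "complete_vfield p (field_H p)"
  by (rule complete_vfieldI[OF field_H_apply, of p "\<lambda>x y z t. x * exp (- t)"
        "\<lambda>x y z t. y * exp t" "\<lambda>x y z t. z"])
    (auto simp: danielewski_def exp_minus field_simps intro!: derivative_eq_intros)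

text \<open>As for V, except that z now solves z' = y z with y constant and so grows
  exponentially.\<close>

lemma complete_zV: "complete_vfield p (z_mult p (field_V p))"
  unfolding z_mult_def
  by (rule complete_vfieldI[OF vf_mult_apply[OF field_V_apply], of p
        "\<lambda>x y z t. if y = 0 then x + t * z * poly (pderiv p) z else poly p (z * exp (t * y)) / y"
        "\<lambda>x y z t. y" "\<lambda>x y z t. z * exp (t * y)"])
    (auto simp: danielewski_def field_simps intro!: derivative_eq_intros)

lemma complete_zW: "complete_vfield p (z_mult p (field_W p))"
  unfolding z_mult_def
  by (rule complete_vfieldI[OF vf_mult_apply[OF field_W_apply], of p "\<lambda>x y z t. x"
        "\<lambda>x y z t. if x = 0 then y + t * z * poly (pderiv p) z else poly p (z * exp (t * x)) / x"
        "\<lambda>x y z t. z * exp (t * x)"])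
    (auto simp: danielewski_def field_simps intro!: derivative_eq_intros)

lemma complete_zH: "complete_vfield p (z_mult p (field_H p))"
  unfolding z_mult_def
  by (rule complete_vfieldI[OF vf_mult_apply[OF field_H_apply], of p
        "\<lambda>x y z t. x * exp (- (t * z))" "\<lambda>x y z t. y * exp (t * z)" "\<lambda>x y z t. z"])
    (auto simp: danielewski_def exp_minus field_simps intro!: derivative_eq_intros)

section \<open>Generating all polynomial vector fields\<close>

definition generators :: "complex poly \<Rightarrow> vfield set" where
  "generators p = {field_V p, field_W p, field_H p,
    z_mult p (field_W p), z_mult p (field_V p), z_mult p (field_H p)}"

abbreviation generated :: "complex poly \<Rightarrow> vfield set" where
  "generated p \<equiv> lie_generated p (generators p)"

lemma coord_z_eq_monofun: "(\<lambda>(x, y, z). z) = monofun [:0, 1:] 0 0"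
  by (auto simp: fun_eq_iff)

lemma generators_in: "generators p \<subseteq> poly_vfields p"
  unfolding generators_def z_mult_def
  by (simp add: field_V_in field_W_in field_H_in vf_mult_in polyfun3.intros)

text \<open>The easy inclusion: derivations form a Lie algebra that contains the generators.\<close>

lemma generated_in: "D \<in> generated p \<Longrightarrow> D \<in> poly_vfields p"
  by (induction rule: lie_generated.induct)
    (use generators_in in \<open>auto intro: vf_zero_in vf_add_in lie_bracket_in vf_mult_in polyfun3.const\<close>)

text \<open>The three fields are linearly dependent over the coordinate ring. This relation later
  trades multiples of W for multiples of V and H, and conversely.\<close>

lemma field_relation:
  assumes "h \<in> coord_ring p" "(x, y, z) \<in> danielewski p"
  shows "y * field_W p h (x, y, z) =
    x * field_V p h (x, y, z) + poly (pderiv p) z * field_H p h (x, y, z)"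
proof -
  obtain P where "P \<in> polyfun3" "h = restrict P (danielewski p)"
    using assms(1) by (rule coord_ringE)
  then show ?thesis
    using assms(2) by (simp add: field_V_apply field_W_apply field_H_apply)
      (simp add: apply_field_def algebra_simps)
qed

text \<open>The common pattern of the generation steps: a field is exhibited as a combination of two
  generated ones and checked pointwise, with the surface equation and \<open>field_relation\<close>
  supplied as premises.\<close>

lemma generated_lincomb:
  assumes "D \<in> generated p" "E \<in> generated p"
    and "\<And>f x y z. f \<in> coord_ring p \<Longrightarrow> (x, y, z) \<in> danielewski p \<Longrightarrow> x * y = poly p z \<Longrightarrow>
      y * field_W p f (x, y, z) =
        x * field_V p f (x, y, z) + poly (pderiv p) z * field_H p f (x, y, z) \<Longrightarrow>
      h (x, y, z) * K f (x, y, z) = a * D f (x, y, z) + b * E f (x, y, z)"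
  shows "vf_mult p h K \<in> generated p"
proof -
  have "vf_mult p h K = vf_add p (vf_mult p (\<lambda>_. a) D) (vf_mult p (\<lambda>_. b) E)"
    unfolding vf_mult_def vf_add_def
    by (rule restrict_ext, simp, rule restrict_ext)
      (use assms(3) field_relation in \<open>auto simp: danielewski_def\<close>)
  then show ?thesis using assms(1,2) by (simp add: lie_generated.add lie_generated.scale)
qed

lemma vf_mult_value:
  "f \<in> coord_ring p \<Longrightarrow> q \<in> danielewski p \<Longrightarrow> vf_mult p h D f q = h q * D f q"
  by (simp add: vf_mult_def)

lemma vf_add_value:
  "f \<in> coord_ring p \<Longrightarrow> q \<in> danielewski p \<Longrightarrow> vf_add p D E f q = D f q + E f q"
  by (simp add: vf_add_def)

lemma vf_mult_cong:
  "(\<And>x y z. x * y = poly p z \<Longrightarrow> h (x, y, z) = h' (x, y, z)) \<Longrightarrow> vf_mult p h D = vf_mult p h' D"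
  by (auto simp: vf_mult_def danielewski_def intro!: restrict_ext)

section \<open>Brackets with monomial multiples of H\<close>

lemma field_H_monofun:
  assumes "(x, y, z) \<in> danielewski p"
  shows "field_H p (restrict (monofun f i j) (danielewski p)) (x, y, z) =
    (of_nat j - of_nat i) * (poly f z * x ^ i * y ^ j)"
  using assms by (cases i; cases j) (simp_all add: field_H_apply apply_field_monofun algebra_simps)

lemma field_V_monofun:
  assumes "(x, y, z) \<in> danielewski p"
  shows "field_V p (restrict (monofun f i j) (danielewski p)) (x, y, z) =
    poly (pderiv p) z * (poly f z * (of_nat i * x ^ (i - 1)) * y ^ j) +
    y * (poly (pderiv f) z * x ^ i * y ^ j)"
  using assms by (simp add: field_V_apply apply_field_monofun)

lemma field_W_monofun:
  assumes "(x, y, z) \<in> danielewski p"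
  shows "field_W p (restrict (monofun f i j) (danielewski p)) (x, y, z) =
    poly (pderiv p) z * (poly f z * x ^ i * (of_nat j * y ^ (j - 1))) +
    x * (poly (pderiv f) z * x ^ i * y ^ j)"
  using assms by (simp add: field_W_apply apply_field_monofun)

text \<open>The numerical factor is the difference l - k - (j - i) of the weights of the two
  coefficients.\<close>

lemma bracket_HH:
  assumes "h \<in> coord_ring p" "(x, y, z) \<in> danielewski p"
  shows "lie_bracket p (vf_mult p (monofun f i j) (field_H p)) (vf_mult p (monofun g k l) (field_H p))
      h (x, y, z) =
    (of_nat l - of_nat k - of_nat j + of_nat i) *
      (poly f z * x ^ i * y ^ j) * (poly g z * x ^ k * y ^ l) * field_H p h (x, y, z)"
  using assms
  by (simp add: bracket_vf_mult[OF field_H_in field_H_in] field_H_monofun)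
    (simp add: lie_bracket_def algebra_simps)

text \<open>Here 1 + l - k is the weight of the second field; the subtracted term comes from V
  differentiating the coefficient of H.\<close>

lemma bracket_HV:
  assumes "h \<in> coord_ring p" "(x, y, z) \<in> danielewski p"
  shows "lie_bracket p (vf_mult p (monofun f i j) (field_H p)) (vf_mult p (monofun g k l) (field_V p))
      h (x, y, z) =
    (1 + of_nat l - of_nat k) * (poly f z * x ^ i * y ^ j) * (poly g z * x ^ k * y ^ l) *
      field_V p h (x, y, z) -
    (poly g z * x ^ k * y ^ l) *
    (poly (pderiv p) z * (poly f z * (of_nat i * x ^ (i - 1)) * y ^ j) +
      y * (poly (pderiv f) z * x ^ i * y ^ j)) * field_H p h (x, y, z)"
  using assms
  by (simp add: bracket_vf_mult[OF field_H_in field_V_in] field_H_monofun field_V_monofun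
      bracket_H_V) (simp add: algebra_simps)

lemma bracket_HW:
  assumes "h \<in> coord_ring p" "(x, y, z) \<in> danielewski p"
  shows "lie_bracket p (vf_mult p (monofun f i j) (field_H p)) (vf_mult p (monofun g k l) (field_W p))
      h (x, y, z) =
    (of_nat l - of_nat k - 1) * (poly f z * x ^ i * y ^ j) * (poly g z * x ^ k * y ^ l) *
      field_W p h (x, y, z) -
    (poly g z * x ^ k * y ^ l) *
    (poly (pderiv p) z * (poly f z * x ^ i * (of_nat j * y ^ (j - 1))) +
      x * (poly (pderiv f) z * x ^ i * y ^ j)) * field_H p h (x, y, z)"
  using assms
  by (simp add: bracket_vf_mult[OF field_H_in field_W_in] field_H_monofun field_W_monofun
      bracket_H_W vf_mult_value) (simp add: algebra_simps)

section \<open>Generated fields of low degree in x and y\<close>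

lemma generated_0: "vf_mult p (monofun 0 i j) K \<in> generated p"
  by (rule generated_lincomb[OF lie_generated.zero lie_generated.zero, where a = 0 and b = 0]) simp

lemma generated_V: "vf_mult p (monofun 1 0 0) (field_V p) \<in> generated p"
  and generated_W: "vf_mult p (monofun 1 0 0) (field_W p) \<in> generated p"
  by (rule generated_lincomb[OF lie_generated.generator lie_generated.zero, where a = 1 and b = 0];
      auto simp: generators_def)+

lemma generated_zV: "vf_mult p (monofun [:0, 1:] 0 0) (field_V p) \<in> generated p"
  and generated_zW: "vf_mult p (monofun [:0, 1:] 0 0) (field_W p) \<in> generated p"
  and generated_zH: "vf_mult p (monofun [:0, 1:] 0 0) (field_H p) \<in> generated p"
  unfolding coord_z_eq_monofun[symmetric] z_mult_def[symmetric]
  by (rule lie_generated.generator, simp add: generators_def)+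

text \<open>Bracketing with zH multiplies f x^i y^j H by (j - i) z. For nonzero weight one can
  divide by j - i, so Horner's scheme builds every f.\<close>

lemma generated_poly_mult_H:
  assumes 1: "vf_mult p (monofun 1 i j) (field_H p) \<in> generated p" and ij: "i \<noteq> j"
  shows "vf_mult p (monofun f i j) (field_H p) \<in> generated p"
proof (induction f)
  case 0
  show ?case by (rule generated_0)
next
  case (pCons a f)
  show ?case
    by (rule generated_lincomb[OF 1 lie_generated.bracket[OF generated_zH pCons.IH],
          where a = a and b = "1 / (of_nat j - of_nat i)"])
      (use ij in \<open>simp add: bracket_HH vf_mult_value\<close>, simp add: algebra_simps)
qed

lemma generated_yH: "vf_mult p (monofun f 0 1) (field_H p) \<in> generated p"
proof -
  have "vf_mult p (monofun 1 0 1) (field_H p) \<in> generated p"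
    by (rule generated_lincomb[OF generated_zV lie_generated.bracket[OF generated_zH generated_V],
          where a = 1 and b = "- 1"]) (simp add: bracket_HV vf_mult_value pderiv_pCons algebra_simps)
  then show ?thesis by (rule generated_poly_mult_H) simp
qed

lemma generated_xH: "vf_mult p (monofun f 1 0) (field_H p) \<in> generated p"
proof -
  have "vf_mult p (monofun 1 1 0) (field_H p) \<in> generated p"
    by (rule generated_lincomb[OF generated_zW lie_generated.bracket[OF generated_zH generated_W],
          where a = "- 1" and b = "- 1"])
      (simp add: bracket_HW vf_mult_value pderiv_pCons algebra_simps)
  then show ?thesis by (rule generated_poly_mult_H) simp
qed

text \<open>Horner's scheme again: [zH, fV] = z f V - f y H, where the error term is already
  generated.\<close>

lemma generated_poly_V: "vf_mult p (monofun f 0 0) (field_V p) \<in> generated p"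
proof (induction f)
  case 0
  show ?case by (rule generated_0)
next
  case (pCons a f)
  have "vf_mult p (monofun (pCons 0 f) 0 0) (field_V p) \<in> generated p"
    by (rule generated_lincomb[OF lie_generated.bracket[OF generated_zH pCons.IH] generated_yH[of p f],
          where a = 1 and b = 1]) (simp add: bracket_HV vf_mult_value pderiv_pCons algebra_simps)
  then show ?case
    by (rule generated_lincomb[OF _ generated_V, where a = 1 and b = a])
      (simp add: vf_mult_value algebra_simps)
qed

lemma generated_poly_W: "vf_mult p (monofun f 0 0) (field_W p) \<in> generated p"
proof (induction f)
  case 0
  show ?case by (rule generated_0)
next
  case (pCons a f)
  have "vf_mult p (monofun (pCons 0 f) 0 0) (field_W p) \<in> generated p"
    by (rule generated_lincomb[OF lie_generated.bracket[OF generated_zH pCons.IH] generated_xH[of p f],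
          where a = "- 1" and b = "- 1"])
      (simp add: bracket_HW vf_mult_value pderiv_pCons algebra_simps)
  then show ?case
    by (rule generated_lincomb[OF _ generated_W, where a = 1 and b = a])
      (simp add: vf_mult_value algebra_simps)
qed

lemma generated_p_H: "vf_mult p (monofun (f * p) 0 0) (field_H p) \<in> generated p"
  by (rule generated_lincomb[OF lie_generated.bracket[OF generated_yH[of p f] generated_xH[of p 1]]
        lie_generated.zero, where a = "- 1 / 2" and b = 0])
    (simp add: bracket_HH algebra_simps)

lemma generated_dp_H: "vf_mult p (monofun (f * pderiv p) 0 0) (field_H p) \<in> generated p"
proof -
  \<comment> \<open>This sum equals f (xV - yW) - 2 f p' H - 2 f' p H = - 3 f p' H - 2 f' p H, which
    explains the coefficients -1/3 and -2/3 below.\<close>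
  have "vf_add p (lie_bracket p (vf_mult p (monofun f 1 0) (field_H p))
        (vf_mult p (monofun 1 0 0) (field_V p)))
      (lie_bracket p (vf_mult p (monofun f 0 1) (field_H p))
        (vf_mult p (monofun 1 0 0) (field_W p))) \<in> generated p"
    by (intro lie_generated.add lie_generated.bracket generated_xH generated_yH generated_V
        generated_W)
  then show ?thesis
    apply (rule generated_lincomb[OF _ generated_p_H[of p "pderiv f"],
          where a = "- 1 / 3" and b = "- 2 / 3"])
    subgoal premises r for h x y z
      \<comment> \<open>The relation between V, W and H enters multiplied by f.\<close>
      using arg_cong[OF r(4), of "\<lambda>t. poly f z * t"]
      by (simp add: r(1,2) r(3)[symmetric] bracket_HV bracket_HW vf_add_value vf_mult_value
          field_simps)
    done
qed

section \<open>Arbitrary powers of x and y, using the Bezout identity\<close>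

locale bezout =
  fixes p u v :: "complex poly"
  assumes bez: "u * p + v * pderiv p = 1"
begin

lemma bez_poly: "poly u z * poly p z + poly v z * poly (pderiv p) z = 1"
  using arg_cong[OF bez, of "\<lambda>f. poly f z"] by simp

lemma bez_mult: "a * poly u z * poly p z + a * poly v z * poly (pderiv p) z = a"
  using bez_poly[of z] by algebra

lemma generated_poly_H: "vf_mult p (monofun f 0 0) (field_H p) \<in> generated p"
  by (rule generated_lincomb[OF generated_p_H[of p "f * u"] generated_dp_H[of p "f * v"],
        where a = 1 and b = 1])
    (simp add: vf_mult_value bez_mult flip: distrib_right)

text \<open>[f xH, V] = f x V - (f p' + f' p) H, and all multiples of H by polynomials in z are now
  available.\<close>

lemma generated_xV: "vf_mult p (monofun f 1 0) (field_V p) \<in> generated p"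
  by (rule generated_lincomb[OF lie_generated.bracket[OF generated_xH[of p f] generated_V]
        generated_poly_H[of "f * pderiv p + pderiv f * p"], where a = 1 and b = 1])
    (simp add: bracket_HV vf_mult_value algebra_simps)

text \<open>This is \<open>field_relation\<close> multiplied by f.\<close>

lemma generated_yW: "vf_mult p (monofun f 0 1) (field_W p) \<in> generated p"
  apply (rule generated_lincomb[OF generated_xV[of f] generated_poly_H[of "f * pderiv p"],
        where a = 1 and b = 1])
  subgoal premises r using r(4) by (simp add: r(1,2) vf_mult_value) algebra
  done

lemma generated_y_power:
  "vf_mult p (monofun f 0 j) (field_H p) \<in> generated p \<and>
   vf_mult p (monofun f 0 j) (field_V p) \<in> generated p"
proof -
  \<comment> \<open>With constant coefficient, [y^j H, f V] = f y^j V has no error term, because V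
    annihilates y.\<close>
  have V: "vf_mult p (monofun f 0 j) (field_V p) \<in> generated p"
    if "\<And>f. vf_mult p (monofun f 0 j) (field_H p) \<in> generated p" for j f
    by (rule generated_lincomb[OF lie_generated.bracket[OF that[of 1] generated_poly_V[of p f]]
          lie_generated.zero, where a = 1 and b = 0]) (simp add: bracket_HV algebra_simps)
  have H: "vf_mult p (monofun f 0 j) (field_H p) \<in> generated p" for j f
  proof (induction j arbitrary: f)
    case 0
    show ?case by (rule generated_poly_H)
  next
    case (Suc j)
    \<comment> \<open>Here the factor z is essential: its derivative along V is y, so the error term
      of [z y^j H, V] is y^(j+1) H.\<close>
    have "vf_mult p (monofun 1 0 (Suc j)) (field_H p) \<in> generated p"
      by (rule generated_lincomb[OF lie_generated.bracket[OF Suc.IH[of "[:0, 1:]"] generated_V]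
            V[OF Suc.IH, of "[:0, 1:]"], where a = "- 1" and b = 1])
        (simp add: bracket_HV vf_mult_value pderiv_pCons algebra_simps)
    then show ?case by (rule generated_poly_mult_H) simp
  qed
  show ?thesis using H V by blast
qed

lemma generated_x_power:
  "vf_mult p (monofun f i 0) (field_H p) \<in> generated p \<and>
   vf_mult p (monofun f i 0) (field_W p) \<in> generated p"
proof -
  have W: "vf_mult p (monofun f i 0) (field_W p) \<in> generated p"
    if "\<And>f. vf_mult p (monofun f i 0) (field_H p) \<in> generated p" for i f
    by (rule generated_lincomb[OF lie_generated.bracket[OF that[of 1] generated_poly_W[of p f]]
          lie_generated.zero, where a = "- 1" and b = 0]) (simp add: bracket_HW algebra_simps)
  have H: "vf_mult p (monofun f i 0) (field_H p) \<in> generated p" for i f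
  proof (induction i arbitrary: f)
    case 0
    show ?case by (rule generated_poly_H)
  next
    case (Suc i)
    have "vf_mult p (monofun 1 (Suc i) 0) (field_H p) \<in> generated p"
      by (rule generated_lincomb[OF lie_generated.bracket[OF Suc.IH[of "[:0, 1:]"] generated_W]
            W[OF Suc.IH, of "[:0, 1:]"], where a = "- 1" and b = "- 1"])
        (simp add: bracket_HW vf_mult_value pderiv_pCons algebra_simps)
    then show ?case by (rule generated_poly_mult_H) simp
  qed
  show ?thesis using H W by blast
qed

text \<open>One factor x turns V into yW - p' H, and a second one absorbs y by xy = p: x^(m+2) V = p
  x^m W - p' x^(m+1) H. Hence the exponents 0 and 1 are treated apart.\<close>

lemma generated_x_power_V: "vf_mult p (monofun f i 0) (field_V p) \<in> generated p"
proof -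
  consider "i = 0" | "i = 1" | m where "i = Suc (Suc m)" by (metis One_nat_def not0_implies_Suc)
  then show ?thesis
  proof cases
    case 3
    show ?thesis unfolding 3
      apply (rule generated_lincomb[OF
            generated_x_power[of "f * p" m, THEN conjunct2]
            generated_x_power[of "f * pderiv p" "Suc m", THEN conjunct1], where a = 1 and b = "- 1"])
      subgoal premises r for h x y z
        using arg_cong[OF r(4), of "\<lambda>t. poly f z * x ^ Suc m * t"]
        by (simp add: r(1,2) r(3)[symmetric] vf_mult_value algebra_simps)
      done
  qed (simp_all add: generated_poly_V generated_xV[unfolded One_nat_def])
qed

lemma generated_y_power_W: "vf_mult p (monofun f 0 j) (field_W p) \<in> generated p"
proof -
  consider "j = 0" | "j = 1" | m where "j = Suc (Suc m)" by (metis One_nat_def not0_implies_Suc)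
  then show ?thesis
  proof cases
    case 3
    show ?thesis unfolding 3
      apply (rule generated_lincomb[OF
            generated_y_power[of "f * p" m, THEN conjunct2]
            generated_y_power[of "f * pderiv p" "Suc m", THEN conjunct1], where a = 1 and b = 1])
      subgoal premises r for h x y z
        using arg_cong[OF r(4), of "\<lambda>t. poly f z * y * y ^ m * t"]
        by (simp add: r(1,2) r(3)[symmetric] vf_mult_value algebra_simps)
      done
  qed (simp_all add: generated_poly_W generated_yW[unfolded One_nat_def])
qed

text \<open>The common power of x and y becomes a power of p(z), so that only a pure power of x or
  of y remains.\<close>

lemma generated_monofun:
  assumes "K \<in> {field_V p, field_W p, field_H p}"
  shows "vf_mult p (monofun f i j) K \<in> generated p"
proof (cases "i \<le> j")
  case True
  have "vf_mult p (monofun f i j) K = vf_mult p (monofun (f * p ^ i) 0 (j - i)) K"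
  proof (rule vf_mult_cong)
    fix x y z assume xy: "x * y = poly p z"
    show "monofun f i j (x, y, z) = monofun (f * p ^ i) 0 (j - i) (x, y, z)"
      using True by (simp add: xy[symmetric] power_mult_distrib mult.assoc flip: power_add)
  qed
  then show ?thesis using assms generated_y_power generated_y_power_W by auto
next
  case False
  have "vf_mult p (monofun f i j) K = vf_mult p (monofun (f * p ^ j) (i - j) 0) K"
  proof (rule vf_mult_cong)
    fix x y z assume xy: "x * y = poly p z"
    have "x ^ j * x ^ (i - j) = x ^ i" using False by (simp flip: power_add)
    then show "monofun f i j (x, y, z) = monofun (f * p ^ j) (i - j) 0 (x, y, z)"
      by (simp add: xy[symmetric] power_mult_distrib mult.assoc mult.left_commute mult.commute)
  qed
  then show ?thesis using assms generated_x_power generated_x_power_V by auto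
qed

end

section \<open>From monomial coefficients to all derivations\<close>

lemma polyfun3_monofun_induct:
  assumes "P \<in> polyfun3" and "\<And>f i j. T (monofun f i j)"
    and "\<And>P Q. T P \<Longrightarrow> T Q \<Longrightarrow> T (\<lambda>q. P q + Q q)"
  shows "T P"
  using assms
proof (induction arbitrary: T)
  case (const c)
  have "(\<lambda>_. c) = monofun [:c:] 0 0" by (auto simp: fun_eq_iff)
  then show ?case using const by simp
next
  case coord_x
  have "(\<lambda>(x, y, z). x) = monofun 1 1 0" by (auto simp: fun_eq_iff)
  then show ?case using coord_x by simp
next
  case coord_y
  have "(\<lambda>(x, y, z). y) = monofun 1 0 1" by (auto simp: fun_eq_iff)
  then show ?case using coord_y by simp
next
  case coord_z
  then show ?case by (simp add: coord_z_eq_monofun)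
next
  case (add P Q)
  have "T P" by (rule add.IH(1)[OF add.prems])
  moreover have "T Q" by (rule add.IH(2)[OF add.prems])
  ultimately show ?case by (rule add.prems(2))
next
  case (mult P Q)
  \<comment> \<open>A product is decomposed one factor at a time: first Q against a fixed monomial,
    then P against Q. The induction hypotheses are used for modified predicates, so \<open>T\<close>
    has to be arbitrary.\<close>
  have "T (\<lambda>q. monofun f i j q * Q q)" for f i j
  proof (rule mult.IH(2)[of "\<lambda>R. T (\<lambda>q. monofun f i j q * R q)"])
    fix g k l
    have "(\<lambda>q. monofun f i j q * monofun g k l q) = monofun (f * g) (i + k) (j + l)"
      by (auto simp: fun_eq_iff power_add)
    then show "T (\<lambda>q. monofun f i j q * monofun g k l q)" by (simp add: mult.prems)
  qed (simp add: distrib_left mult.prems)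
  then show ?case
    by (rule mult.IH(1)[of "\<lambda>R. T (\<lambda>q. R q * Q q)"]) (simp add: distrib_right mult.prems)
qed

context bezout
begin

lemma generated_module:
  assumes "P \<in> polyfun3" and K: "K \<in> {field_V p, field_W p, field_H p}"
  shows "vf_mult p P K \<in> generated p"
  using assms(1)
proof (rule polyfun3_monofun_induct)
  fix P Q assume "vf_mult p P K \<in> generated p" "vf_mult p Q K \<in> generated p"
  then show "vf_mult p (\<lambda>q. P q + Q q) K \<in> generated p"
    by (rule generated_lincomb[where a = 1 and b = 1]) (simp add: vf_mult_value algebra_simps)
qed (rule generated_monofun[OF K])

text \<open>For a field \<open>D = a \<partial>/\<partial>x + b \<partial>/\<partial>y + c \<partial>/\<partial>z\<close> tangent to the surface one has
  \<open>p' D = a V + b W\<close> and \<open>y D = c V + b H\<close>; hence \<open>D = u x (y D) + v (p' D)\<close> is a combination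
  of \<open>V\<close>, \<open>W\<close> and \<open>H\<close>.\<close>

lemma poly_vfields_generated:
  assumes D: "D \<in> poly_vfields p"
  shows "D \<in> generated p"
proof -
  let ?S = "danielewski p"
  obtain a where a: "a \<in> polyfun3" "D (restrict (\<lambda>(x, y, z). x) ?S) = restrict a ?S"
    using poly_vfieldsD(2)[OF D restrict_in_coord_ring[OF polyfun3.coord_x]] by (rule coord_ringE)
  obtain b where b: "b \<in> polyfun3" "D (restrict (\<lambda>(x, y, z). y) ?S) = restrict b ?S"
    using poly_vfieldsD(2)[OF D restrict_in_coord_ring[OF polyfun3.coord_y]] by (rule coord_ringE)
  obtain c where c: "c \<in> polyfun3" "D (restrict (\<lambda>(x, y, z). z) ?S) = restrict c ?S"
    using poly_vfieldsD(2)[OF D restrict_in_coord_ring[OF polyfun3.coord_z]] by (rule coord_ringE)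
  have tan: "y * a (x, y, z) + x * b (x, y, z) = poly (pderiv p) z * c (x, y, z)"
    if q: "(x, y, z) \<in> ?S" for x y z
  proof -
    \<comment> \<open>Tangency follows by applying D to both sides of the equation xy = p(z), which
      holds in the coordinate ring.\<close>
    have "restrict (monofun 1 1 1) ?S = restrict (monofun p 0 0) ?S"
      by (auto simp: danielewski_def intro!: restrict_ext)
    then have "D (restrict (monofun 1 1 1) ?S) (x, y, z) = D (restrict (monofun p 0 0) ?S) (x, y, z)"
      by simp
    then show ?thesis
      unfolding poly_vfields_chain_rule[OF D monofun_polyfun3 q] apply_field_monofun
      using q by (simp add: a b c algebra_simps)
  qed
  \<comment> \<open>The coefficients of V, W and H in u x (cV + bH) + v (aV + bW).\<close>
  let ?f = "\<lambda>q. monofun u 1 0 q * c q + monofun v 0 0 q * a q"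
  let ?g = "\<lambda>q. monofun v 0 0 q * b q"
  let ?h = "\<lambda>q. monofun u 1 0 q * b q"
  have fgh: "?f \<in> polyfun3" "?g \<in> polyfun3" "?h \<in> polyfun3"
    by (intro polyfun3.add polyfun3.mult monofun_polyfun3 a b c)+
  let ?E = "vf_add p (vf_add p (vf_mult p ?f (field_V p)) (vf_mult p ?g (field_W p)))
    (vf_mult p ?h (field_H p))"
  have "?E \<in> generated p"
    by (intro lie_generated.add generated_module fgh) auto
  moreover have "D = ?E"
  proof (rule poly_vfields_eqI[OF D generated_in[OF \<open>?E \<in> generated p\<close>]])
    fix x y z assume q: "(x, y, z) \<in> ?S"
    then have xy: "x * y = poly p z" by (simp add: danielewski_def)
    note simps = vf_add_value vf_mult_value a(2) b(2) c(2) field_V_coord field_W_coord field_H_coord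
      polyfun3.intros q
    note eqs = tan[OF q] xy bez_poly[of z]
    show "D (restrict (\<lambda>(x, y, z). x) ?S) (x, y, z) = ?E (restrict (\<lambda>(x, y, z). x) ?S) (x, y, z)"
      using eqs by (simp add: simps) algebra
    show "D (restrict (\<lambda>(x, y, z). y) ?S) (x, y, z) = ?E (restrict (\<lambda>(x, y, z). y) ?S) (x, y, z)"
      using eqs by (simp add: simps) algebra
    show "D (restrict (\<lambda>(x, y, z). z) ?S) (x, y, z) = ?E (restrict (\<lambda>(x, y, z). z) ?S) (x, y, z)"
      using eqs by (simp add: simps) algebra
  qed
  ultimately show ?thesis by simp
qed

end

section \<open>The Bezout identity from simple zeros\<close>

lemma bezout_pderiv:
  fixes p :: "complex poly"
  assumes deg: "degree p > 0" and simple: "\<And>a. poly p a = 0 \<Longrightarrow> order a p = 1"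
  shows "\<exists>u v. u * p + v * pderiv p = 1"
proof -
  let ?g = "gcd p (pderiv p)"
  have p0: "p \<noteq> 0" using deg by auto
  \<comment> \<open>Over the complex numbers a nonconstant gcd would have a zero. As a common zero
    of p and p' it would have order at least 2 in p, against simplicity.\<close>
  have "degree ?g = 0"
  proof (rule ccontr)
    assume "degree ?g \<noteq> 0"
    then obtain a where "poly ?g a = 0"
      using fundamental_theorem_of_algebra_alt[of ?g] by (metis degree_pCons_0)
    then have "poly p a = 0" "poly (pderiv p) a = 0"
      by (metis dvdE gcd_dvd1 mult_zero_left poly_mult, metis dvdE gcd_dvd2 mult_zero_left poly_mult)
    moreover have "pderiv p \<noteq> 0" using deg by (simp add: pderiv_eq_0_iff)
    ultimately have "order a p = Suc (order a (pderiv p))" "order a (pderiv p) \<noteq> 0"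
      using order_pderiv[OF p0] order_root by blast+
    then show False using simple[OF \<open>poly p a = 0\<close>] by simp
  qed
  then have "?g dvd 1" using p0 by (metis is_unit_iff_degree gcd_eq_0_iff)
  then have "?g = 1" using is_unit_gcd_iff by blast
  then show ?thesis by (metis bezout_coefficients_fst_snd)
qed

theorem theorem3p2:
  fixes p :: "complex poly"
  assumes nonconstant: "degree p > 0"
    and simple_zeros: "\<And>a. poly p a = 0 \<Longrightarrow> order a p = 1"
  shows "(\<forall>D \<in> {field_V p, field_W p, field_H p,
              z_mult p (field_W p), z_mult p (field_V p), z_mult p (field_H p)}.
            complete_vfield p D) \<and>
         lie_generated p {field_V p, field_W p, field_H p,
              z_mult p (field_W p), z_mult p (field_V p), z_mult p (field_H p)} =
         poly_vfields p"
proof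
  have gens: "{field_V p, field_W p, field_H p,
      z_mult p (field_W p), z_mult p (field_V p), z_mult p (field_H p)} = generators p"
    by (simp add: generators_def)
  show "\<forall>D \<in> {field_V p, field_W p, field_H p,
      z_mult p (field_W p), z_mult p (field_V p), z_mult p (field_H p)}. complete_vfield p D"
    using complete_V complete_W complete_H complete_zV complete_zW complete_zH by blast
  obtain u v where "u * p + v * pderiv p = 1"
    using bezout_pderiv[OF nonconstant simple_zeros] by blast
  then show "lie_generated p {field_V p, field_W p, field_H p,
      z_mult p (field_W p), z_mult p (field_V p), z_mult p (field_H p)} = poly_vfields p"
    unfolding gens using generated_in bezout.poly_vfields_generated[of p u v]
    by (auto simp: bezout_def)
qed

end
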